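(* Let $Q$ be a finite connected quandle with elements $1,2,\dots,n$ naturally ordered and with profile $\{1,\ell_1,\ell_2,\dots,\ell_k\}$, where $k\ge1$ and $1\le\ell_1<\ell_2<\cdots<\ell_k$. Then the number of distinct matrices in canonical form that arise as the quandle matrix of $Q$ after reordering by some bijection $\nu:\{1,\dots,n\}\to\{1,\dots,n\}$ is at most $\ell_1\ell_2\cdots\ell_{k-1}$ (the empty product being $1$). In particular, when $k=1$, or when $k=2$ and $\ell_1=1$, the canonical form of the quandle matrix for $Q$ is unique.
   Context: A quandle is a set $Q$ with a binary operation $*$ such that: (1) $a*a=a$ for all $a\in Q$; (2) for all $a,b\in Q$ there is a unique $c\in Q$ with $a=c*b$; (3) $(a*b)*c=(a*c)*(b*c)$ for all $a,b,c\in Q$. For $b\in Q$ let $r_b:Q\to Q$, $r_b(x)=x*b$ (a bijection), and write $a\,\bar{*}\,b=r_b^{-1}(a)$. $Q$ is connected if for every $a\in Q$ the orbit $\{(\cdots((a\star_1 b_1)\star_2 b_2)\cdots\star_m b_m) : m\ge 0,\ b_i\in Q,\ \star_i\in\{*,\bar{*}\}\}$ equals $Q$. Let $Q$ be a finite connected quandle with underlying set $\{1,\dots,n\}$. In this case all the permutations $r_1,\dots,r_n$ are conjugate in the symmetric group; the profile of $Q$ is the multiset of lengths of the cycles in the disjoint cycle decomposition of $r_n$ (cycles of length $1$ included). Since $r_n(n)=n$, the profile contains $1$ and is written $\{1,\ell_1,\dots,\ell_k\}$. The cycle notation $(i_1\ i_2\ \cdots\ i_\ell)$ means $i_1\mapsto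 i_2\mapsto\cdots\mapsto i_\ell\mapsto i_1$. The quandle matrix of $Q$ is the $n\times n$ matrix whose entry in row $i$ and column $j$ is $i*j$. For a bijection $\nu:\{1,\dots,n\}\to\{1,\dots,n\}$, the quandle matrix after reordering by $\nu$ is the matrix whose entry in row $\nu(i)$ and column $\nu(j)$ is $\nu(i*j)$. The elements of $Q$ are naturally ordered, and the quandle matrix of $Q$ is in canonical form, if $r_n$ (the permutation sending $i$ to the entry in row $i$ of the $n$th column) equals $(1\ 2\cdots \ell_1)(\ell_1+1\ \cdots\ \ell_1+\ell_2)\cdots\bigl(\sum_{j=1}^{k-1}\ell_j+1\ \cdots\ \sum_{j=1}^{k-1}\ell_j+\ell_k\bigr)(n)$ with $1\le\ell_1\le\cdots\le\ell_k$. The same definition applies to the quandle matrix after a reordering, using the permutation given by its $n$th column. *)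

theory Defs
  imports "HOL-Combinatorics.Combinatorics" "HOL-Library.FuncSet" "HOL-Library.Multiset"
begin

locale quandle =
  fixes Q :: "'a set" and op :: "'a \<Rightarrow> 'a \<Rightarrow> 'a"
  assumes closed: "\<And>a b. a \<in> Q \<Longrightarrow> b \<in> Q \<Longrightarrow> op a b \<in> Q"
    and idem: "\<And>a. a \<in> Q \<Longrightarrow> op a a = a"
    and right_div: "\<And>a b. a \<in> Q \<Longrightarrow> b \<in> Q \<Longrightarrow> \<exists>!c. c \<in> Q \<and> a = op c b"
    and self_distrib: "\<And>a b c. a \<in> Q \<Longrightarrow> b \<in> Q \<Longrightarrow> c \<in> Q \<Longrightarrow>
      op (op a b) c = op (op a c) (op b c)"

definition quandle_bar :: "'a set \<Rightarrow> ('a \<Rightarrow> 'a \<Rightarrow> 'a) \<Rightarrow> 'a \<Rightarrow> 'a \<Rightarrow> 'a" where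
  "quandle_bar Q op a b = the_inv_into Q (\<lambda>x. op x b) a"

inductive_set quandle_orbit :: "'a set \<Rightarrow> ('a \<Rightarrow> 'a \<Rightarrow> 'a) \<Rightarrow> 'a \<Rightarrow> 'a set"
  for Q op a where
  base: "a \<in> quandle_orbit Q op a"
| op: "x \<in> quandle_orbit Q op a \<Longrightarrow> b \<in> Q \<Longrightarrow> op x b \<in> quandle_orbit Q op a"
| bar: "x \<in> quandle_orbit Q op a \<Longrightarrow> b \<in> Q \<Longrightarrow> quandle_bar Q op x b \<in> quandle_orbit Q op a"

locale connected_quandle = quandle +
  assumes connected: "\<And>a. a \<in> Q \<Longrightarrow> quandle_orbit Q op a = Q"

text \<open>The supports of the cycles of a permutation, fixed points included, are its orbits.\<close>

definition profile :: "nat \<Rightarrow> (nat \<Rightarrow> nat \<Rightarrow> nat) \<Rightarrow> nat multiset" where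
  "profile n op = image_mset card (mset_set (orbit (\<lambda>i. op i n) ` {1..n}))"

text \<open>An $n$ by $n$ matrix is a function on pairs (row, column), undefined outside
  \<open>{1..n} \<times> {1..n}\<close>, so that equality of functions is equality of matrices.\<close>

type_synonym qmatrix = "nat \<times> nat \<Rightarrow> nat"

definition quandle_matrix :: "nat \<Rightarrow> (nat \<Rightarrow> nat \<Rightarrow> nat) \<Rightarrow> qmatrix" where
  "quandle_matrix n op = (\<lambda>(i, j)\<in>{1..n} \<times> {1..n}. op i j)"

definition reordered_matrix :: "nat \<Rightarrow> (nat \<Rightarrow> nat) \<Rightarrow> (nat \<Rightarrow> nat \<Rightarrow> nat) \<Rightarrow> qmatrix" where
  "reordered_matrix n \<nu> op = (\<lambda>(i, j)\<in>{1..n} \<times> {1..n}.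
     \<nu> (op (the_inv_into {1..n} \<nu> i) (the_inv_into {1..n} \<nu> j)))"

lemma reordered_matrix_entry:
  assumes "bij_betw \<nu> {1..n} {1..n}" "i \<in> {1..n}" "j \<in> {1..n}"
  shows "reordered_matrix n \<nu> op (\<nu> i, \<nu> j) = \<nu> (op i j)"
proof -
  have "\<nu> i \<in> {1..n}" "\<nu> j \<in> {1..n}"
    using assms bij_betwE by blast+
  then show ?thesis
    using assms by (simp add: reordered_matrix_def the_inv_into_f_f bij_betw_imp_inj_on)
qed

text \<open>\<open>consecutive_cycles s [l\<^sub>1, \<dots>, l\<^sub>k]\<close> is the permutation
  $(s+1\ \cdots\ s+l_1)(s+l_1+1\ \cdots\ s+l_1+l_2)\cdots$.\<close>

fun consecutive_cycles :: "nat \<Rightarrow> nat list \<Rightarrow> nat \<Rightarrow> nat" where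
  "consecutive_cycles s [] = id"
| "consecutive_cycles s (l # ls) =
     cycle_of_list [s + 1..<s + l + 1] \<circ> consecutive_cycles (s + l) ls"

text \<open>The trailing cycle $(n)$ is accounted for by the condition on the sum of the lengths.\<close>

definition canonical_form :: "nat \<Rightarrow> qmatrix \<Rightarrow> bool" where
  "canonical_form n M \<longleftrightarrow> (\<exists>ls. sorted ls \<and> (\<forall>l\<in>set ls. 1 \<le> l) \<and> sum_list ls + 1 = n \<and>
     (\<forall>i\<in>{1..n}. M (i, n) = consecutive_cycles 0 ls i))"

abbreviation naturally_ordered :: "nat \<Rightarrow> (nat \<Rightarrow> nat \<Rightarrow> nat) \<Rightarrow> bool" where
  "naturally_ordered n op \<equiv> canonical_form n (quandle_matrix n op)"

definition canonical_reorderings :: "nat \<Rightarrow> (nat \<Rightarrow> nat \<Rightarrow> nat) \<Rightarrow> qmatrix set" where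
  "canonical_reorderings n op =
     {M. canonical_form n M \<and> (\<exists>\<nu>. bij_betw \<nu> {1..n} {1..n} \<and> M = reordered_matrix n \<nu> op)}"

end

theory Submission
  imports Defs
begin

text \<open>Connectedness provides an automorphism carrying \<open>\<nu>\<inverse> n\<close> to \<open>n\<close>, and precomposing \<open>\<nu>\<close> with
  the inverse of an automorphism does not change the reordered matrix. Hence one may assume that
  \<open>\<nu>\<close> fixes \<open>n\<close>, so that it commutes with \<open>r\<^sub>n\<close> and, the cycles other than \<open>(n)\<close>
  having distinct lengths, preserves each cycle of \<open>r\<^sub>n\<close>. Composing with a power of the automorphism \<open>r\<^sub>n\<close>, one
  may further assume that \<open>\<nu>\<close> fixes a chosen point of the longest cycle. Such a \<open>\<nu>\<close> is determined
  by the image of one representative in each of the remaining cycles, which leaves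
  \<open>l\<^sub>1 \<cdots> l\<^bsub>k-1\<^esub>\<close> possibilities.\<close>

section \<open>Permutations and their orbits\<close>

text \<open>The \<open>k\<close>-th iterate sends the first entry to the entry at index
  \<open>k mod length cs\<close>, so the orbit of the first entry is the whole list. A set on which
  a map is cyclic is the orbit of each of its points.\<close>

lemma orbit_cycle_of_list:
  assumes "distinct cs" "x \<in> set cs"
  shows "orbit (cycle_of_list cs) x = set cs"
proof -
  have ne: "cs \<noteq> []" using assms by auto
  have pow: "(cycle_of_list cs ^^ k) (cs ! 0) = cs ! (k mod length cs)" for k
  proof -
    have "(cycle_of_list cs ^^ k) (cs ! 0) = map (cycle_of_list cs ^^ k) cs ! 0"
      using ne by simp
    also have "\<dots> = cs ! (k mod length cs)"
      using ne by (simp add: cyclic_rotation[OF assms(1)] nth_rotate)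
    finally show ?thesis .
  qed
  have "orbit (cycle_of_list cs) (cs ! 0) = {cs ! (k mod length cs) | k. True}"
    by (simp add: orbit_altdef_permutation[OF permutation_of_cycle] pow)
  also have "\<dots> = set cs"
    using ne by (auto simp: set_conv_nth) (metis mod_less)
  finally have "cyclic_on (cycle_of_list cs) (set cs)"
    using ne by (intro cyclic_on_singleI[of "cs ! 0"]) auto
  then show ?thesis
    using assms(2) by (rule orbit_cyclic_eq3)
qed

lemma orbit_image_commute:
  assumes "f permutes A" "finite A" "x \<in> A"
    and "\<And>y. y \<in> A \<Longrightarrow> \<nu> (f y) = g (\<nu> y)"
  shows "orbit g (\<nu> x) = \<nu> ` orbit f x"
proof (rule orbit_inverse[symmetric])
  show "x \<in> orbit f x"
    using assms(1,2) by (meson permutation_permutes permutation_self_in_orbit)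
  show "g (\<nu> y) = \<nu> (f y)" if "y \<in> orbit f x" for y
    using that permutes_orbit_subset[OF assms(1,3)] assms(4) by auto
qed

text \<open>\<open>\<nu>\<close> carries orbits injectively to orbits of the same size. It maps the
  orbit of \<open>a\<close> to itself, hence every other orbit to one different from it, and among
  these the size identifies the orbit. Setting \<open>a\<close> apart allows the shortest remaining
  cycle to have length 1, the length of \<open>(n)\<close>.\<close>

lemma commuting_preserves_orbits:
  assumes f: "f permutes A" "finite A" and \<nu>: "inj_on \<nu> A" "\<nu> ` A \<subseteq> A"
    and comm: "\<And>y. y \<in> A \<Longrightarrow> \<nu> (f y) = f (\<nu> y)"
    and a: "a \<in> A" "\<nu> a \<in> orbit f a"
    and inj: "inj_on card (orbit f ` A - {orbit f a})"
    and x: "x \<in> A"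
  shows "\<nu> x \<in> orbit f x"
proof -
  have perm: "permutation f" using f by (auto simp: permutation_permutes)
  have self: "y \<in> orbit f y" for y using perm by (rule permutation_self_in_orbit)
  have img: "orbit f (\<nu> y) = \<nu> ` orbit f y" if "y \<in> A" for y
    using orbit_image_commute[where g = f and \<nu> = \<nu>, OF f that comm] by blast
  have sub: "orbit f y \<subseteq> A" if "y \<in> A" for y
    using permutes_orbit_subset[OF f(1) that] .
  have a': "orbit f (\<nu> a) = orbit f a"
    using orbit_cyclic_eq3[OF cyclic_on_orbit'[OF perm] a(2)] .
  have "orbit f (\<nu> x) = orbit f x"
  proof (cases "orbit f x = orbit f a")
    case True
    then show ?thesis using img x a a' by metis
  next
    case False
    have "orbit f (\<nu> x) \<noteq> orbit f a"
      using False img[OF x] img[OF a(1)] a' inj_on_image_eq_iff[OF \<nu>(1)] sub x a(1) by metis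
    moreover have "card (orbit f (\<nu> x)) = card (orbit f x)"
      using img[OF x] \<nu>(1) sub[OF x] by (metis card_image inj_on_subset)
    ultimately show ?thesis
      using inj_onD[OF inj] x \<nu>(2) False by blast
  qed
  then show ?thesis using self by metis
qed

text \<open>Commutation propagates the agreement from \<open>r\<close> along its cycle, so one value
  per cycle determines a commuting map. The induction starts at \<open>f r\<close>, where
  \<open>orbit\<close> is generated from.\<close>

lemma commuting_eqI:
  assumes "f permutes A" "r \<in> A" "\<nu> r = \<mu> r"
    and "\<And>y. y \<in> A \<Longrightarrow> \<nu> (f y) = f (\<nu> y)" "\<And>y. y \<in> A \<Longrightarrow> \<mu> (f y) = f (\<mu> y)"
    and "x \<in> orbit f r"
  shows "\<nu> x = \<mu> x"
  using assms(6)
proof induction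
  case base
  then show ?case using assms by simp
next
  case (step y)
  then have "y \<in> A" using permutes_orbit_subset[OF assms(1,2)] by auto
  then show ?case using assms step by simp
qed

section \<open>Cycle type of a product of consecutive cycles\<close>

lemma consecutive_cycles_permutes:
  "consecutive_cycles s ls permutes {s + 1..s + sum_list ls}"
proof (induction ls arbitrary: s)
  case Nil
  then show ?case by (simp add: permutes_def)
next
  case (Cons l ls)
  have "cycle_of_list [s + 1..<s + l + 1] permutes {s + 1..s + sum_list (l # ls)}"
    by (rule permutes_subset[OF cycle_permutes]) auto
  moreover have "consecutive_cycles (s + l) ls permutes {s + 1..s + sum_list (l # ls)}"
    by (rule permutes_subset[OF Cons.IH]) auto
  ultimately show ?case
    by (simp only: consecutive_cycles.simps permutes_compose)
qed

text \<open>The first cycle and the remaining product move points of disjoint intervals. On each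
  interval the product agrees with the factor living there and has the same orbits, so the first
  block adds \<open>l\<close> to the sizes given by induction.\<close>

lemma orbits_consecutive_cycles:
  assumes "\<forall>l\<in>set ls. 1 \<le> l"
  shows "image_mset card (mset_set (orbit (consecutive_cycles s ls) ` {s + 1..s + sum_list ls})) = mset ls"
  using assms
proof (induction ls arbitrary: s)
  case Nil
  then show ?case by simp
next
  case (Cons l ls)
  let ?c = "cycle_of_list [s + 1..<s + l + 1]" and ?g = "consecutive_cycles (s + l) ls"
  let ?f = "consecutive_cycles s (l # ls)"
  let ?B = "{s + 1..s + l}" and ?C = "{s + l + 1..s + l + sum_list ls}"
  have g: "?g permutes ?C" by (rule consecutive_cycles_permutes)
  have set: "set [s + 1..<s + l + 1] = ?B" by auto
  have fB: "?f x = ?c x" if "x \<in> ?B" for x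
    using permutes_not_in[OF g, of x] that by simp
  have fC: "?f x = ?g x" if "x \<in> ?C" for x
  proof -
    have "?g x \<in> ?C" using permutes_in_image[OF g] that by blast
    then show ?thesis by (simp add: id_outside_supp del: upt_Suc)
  qed
  have oB: "orbit ?f x = ?B" if "x \<in> ?B" for x
  proof -
    have "?c permutes ?B" using cycle_permutes[of "[s + 1..<s + l + 1]"] by (simp only: set)
    then have "orbit ?c x = orbit ?f x"
      by (intro orbit_cong0[OF that]) (auto simp only: fB permutes_in_image)
    moreover have "orbit ?c x = ?B"
      using orbit_cycle_of_list[of "[s + 1..<s + l + 1]" x] that by (simp only: set distinct_upt)
    ultimately show ?thesis by simp
  qed
  have oC: "orbit ?f x = orbit ?g x" if "x \<in> ?C" for x
    using that g by (intro orbit_cong0[OF that, symmetric]) (auto simp only: fC permutes_in_image)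
  have "{s + 1..s + sum_list (l # ls)} = ?B \<union> ?C" by auto
  moreover have "orbit ?f ` ?B = {?B}"
    using oB Cons.prems by (auto simp del: consecutive_cycles.simps intro!: image_eqI[of _ _ "s + 1"])
  moreover have "orbit ?f ` ?C = orbit ?g ` ?C"
    using oC by (rule image_cong[OF refl])
  ultimately have eq: "orbit ?f ` {s + 1..s + sum_list (l # ls)} = insert ?B (orbit ?g ` ?C)"
    by (simp only: image_Un) simp
  \<comment> \<open>Orbits are collected in a set, so the first block must be shown to be new. It
    contains \<open>s + 1\<close>, as \<open>l\<close> is positive, while the later orbits lie to
    the right of it.\<close>
  have "?B \<notin> orbit ?g ` ?C"
  proof
    assume "?B \<in> orbit ?g ` ?C"
    then have "?B \<subseteq> ?C" using permutes_orbit_subset[OF g] by blast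
    moreover have "s + 1 \<in> ?B" using Cons.prems by simp
    ultimately have "s + 1 \<in> ?C" by blast
    then show False using Cons.prems by simp
  qed
  then have "image_mset card (mset_set (orbit ?f ` {s + 1..s + sum_list (l # ls)}))
      = add_mset (card ?B) (image_mset card (mset_set (orbit ?g ` ?C)))"
    unfolding eq by simp
  also have "image_mset card (mset_set (orbit ?g ` ?C)) = mset ls"
    by (rule Cons.IH) (use Cons.prems in auto)
  finally show ?case by simp
qed

lemma consecutive_cycles_orbit_last:
  "orbit (consecutive_cycles 0 ls) (sum_list ls + 1) = {sum_list ls + 1}"
  using permutes_not_in[OF consecutive_cycles_permutes[of 0 ls]]
  by (simp add: orbit_eq_singleton_iff)

lemma orbits_consecutive_cycles_Suc:
  assumes "n = sum_list ls + 1"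
  shows "orbit (consecutive_cycles 0 ls) ` {1..n}
         = insert {n} (orbit (consecutive_cycles 0 ls) ` {1..sum_list ls})"
    and "{n} \<notin> orbit (consecutive_cycles 0 ls) ` {1..sum_list ls}"
proof -
  have "{1..n} = insert n {1..sum_list ls}" using assms by auto
  then show "orbit (consecutive_cycles 0 ls) ` {1..n}
         = insert {n} (orbit (consecutive_cycles 0 ls) ` {1..sum_list ls})"
    using consecutive_cycles_orbit_last assms by simp
  show "{n} \<notin> orbit (consecutive_cycles 0 ls) ` {1..sum_list ls}"
    using permutes_orbit_subset[OF consecutive_cycles_permutes[of 0 ls]] assms by fastforce
qed

lemma orbit_cards_consecutive_cycles:
  assumes "\<forall>l\<in>set ls. 1 \<le> l" "n = sum_list ls + 1"
  shows "image_mset card (mset_set (orbit (consecutive_cycles 0 ls) ` {1..n})) = add_mset 1 (mset ls)"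
  using orbits_consecutive_cycles[OF assms(1), of 0] orbits_consecutive_cycles_Suc[OF assms(2)]
  by simp

section \<open>Quandle automorphisms\<close>

definition quandle_aut :: "'a set \<Rightarrow> ('a \<Rightarrow> 'a \<Rightarrow> 'a) \<Rightarrow> ('a \<Rightarrow> 'a) \<Rightarrow> bool" where
  "quandle_aut Q op \<phi> \<longleftrightarrow> bij_betw \<phi> Q Q \<and> (\<forall>a\<in>Q. \<forall>b\<in>Q. \<phi> (op a b) = op (\<phi> a) (\<phi> b))"

lemma quandle_aut_id: "quandle_aut Q op id"
  by (simp add: quandle_aut_def)

lemma quandle_aut_comp:
  assumes "quandle_aut Q op \<phi>" "quandle_aut Q op \<psi>"
  shows "quandle_aut Q op (\<phi> \<circ> \<psi>)"
  using assms unfolding quandle_aut_def by (auto intro: bij_betw_trans dest: bij_betwE)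

lemma quandle_aut_funpow:
  assumes "quandle_aut Q op \<phi>"
  shows "quandle_aut Q op (\<phi> ^^ k)"
proof (induction k)
  case 0
  then show ?case by (simp only: funpow.simps quandle_aut_id)
next
  case (Suc k)
  then show ?case by (simp only: funpow.simps quandle_aut_comp[OF assms])
qed

context quandle
begin

lemma quandle_aut_inv:
  assumes "quandle_aut Q op \<phi>"
  shows "quandle_aut Q op (the_inv_into Q \<phi>)"
proof -
  have bij: "bij_betw \<phi> Q Q" and hom: "\<And>a b. a \<in> Q \<Longrightarrow> b \<in> Q \<Longrightarrow> \<phi> (op a b) = op (\<phi> a) (\<phi> b)"
    using assms by (auto simp: quandle_aut_def)
  have inj: "inj_on \<phi> Q" using bij by (rule bij_betw_imp_inj_on)
  have "the_inv_into Q \<phi> (op a b) = op (the_inv_into Q \<phi> a) (the_inv_into Q \<phi> b)"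
    if "a \<in> Q" "b \<in> Q" for a b
  proof -
    have "a \<in> \<phi> ` Q" "b \<in> \<phi> ` Q"
      using that bij by (simp_all add: bij_betw_def)
    then obtain a' b' where ab: "a' \<in> Q" "b' \<in> Q" "a = \<phi> a'" "b = \<phi> b'"
      by blast
    then have "the_inv_into Q \<phi> (op a b) = op a' b'"
      using the_inv_into_f_f[OF inj closed] hom by metis
    then show ?thesis using ab by (simp add: the_inv_into_f_f[OF inj])
  qed
  then show ?thesis
    using bij_betw_the_inv_into[OF bij] by (simp add: quandle_aut_def)
qed

text \<open>Unique right division is bijectivity of the translation, and self-distributivity is its
  homomorphism law.\<close>

lemma quandle_aut_translation:
  assumes "b \<in> Q"
  shows "quandle_aut Q op (\<lambda>x. op x b)"
proof -
  have "inj_on (\<lambda>x. op x b) Q"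
    by (rule inj_onI) (metis right_div closed assms)
  moreover have "(\<lambda>x. op x b) ` Q = Q"
    using right_div[OF _ assms] closed[OF _ assms] by blast
  ultimately show ?thesis
    using self_distrib assms by (simp add: quandle_aut_def bij_betw_def)
qed

text \<open>Each step of the orbit applies a right translation or the inverse of one, and
  automorphisms are closed under inverse and composition.\<close>

lemma quandle_aut_orbit:
  assumes "x \<in> quandle_orbit Q op a"
  shows "\<exists>\<phi>. quandle_aut Q op \<phi> \<and> \<phi> a = x"
  using assms
proof induction
  case base
  then show ?case by (metis quandle_aut_id id_apply)
next
  case (op x b)
  then show ?case
    by (metis (no_types, lifting) quandle_aut_comp quandle_aut_translation comp_apply)
next
  case (bar x b)
  then obtain \<phi> where \<phi>: "quandle_aut Q op \<phi>" "\<phi> a = x" by blast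
  have "quandle_aut Q op (the_inv_into Q (\<lambda>x. op x b) \<circ> \<phi>)"
    using bar \<phi> by (intro quandle_aut_comp quandle_aut_inv quandle_aut_translation)
  then show ?case
    using \<phi> by (auto simp: quandle_bar_def)
qed

end

lemma (in connected_quandle) quandle_aut_transitive:
  assumes "a \<in> Q" "b \<in> Q"
  shows "\<exists>\<phi>. quandle_aut Q op \<phi> \<and> \<phi> a = b"
  using quandle_aut_orbit connected assms by metis

section \<open>Reordered matrices\<close>

text \<open>By surjectivity every index pair has the form \<open>(\<nu> i, \<nu> j)\<close>, so
  entries can be compared without the inverse of \<open>\<nu>\<close>; extensionality settles all
  other arguments.\<close>

lemma reordered_matrix_eqI:
  assumes bij: "bij_betw \<nu> {1..n} {1..n}"
    and entry: "\<And>i j. i \<in> {1..n} \<Longrightarrow> j \<in> {1..n} \<Longrightarrow> M (\<nu> i, \<nu> j) = \<nu> (op i j)"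
    and ext: "M \<in> extensional ({1..n} \<times> {1..n})"
  shows "reordered_matrix n \<nu> op = M"
proof (rule extensionalityI[OF _ ext])
  show "reordered_matrix n \<nu> op \<in> extensional ({1..n} \<times> {1..n})"
    unfolding reordered_matrix_def by (rule restrict_extensional)
  fix p assume "p \<in> {1..n} \<times> {1..n}"
  then obtain i j where ij: "i \<in> {1..n}" "j \<in> {1..n}" "p = (\<nu> i, \<nu> j)"
    using bij by (auto simp: bij_betw_def image_iff simp del: atLeastAtMost_iff)
      (metis (no_types, lifting) imageE)
  then show "reordered_matrix n \<nu> op p = M p"
    using entry reordered_matrix_entry[OF bij] by metis
qed

lemma extensional_reordered_matrix:
  "reordered_matrix n \<nu> op \<in> extensional ({1..n} \<times> {1..n})"
  unfolding reordered_matrix_def by (rule restrict_extensional)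

text \<open>The entry at \<open>(\<mu> (\<phi> i), \<mu> (\<phi> j))\<close> is
  \<open>\<mu> (op (\<phi> i) (\<phi> j))\<close> on one side and
  \<open>\<mu> (\<phi> (op i j))\<close> on the other.\<close>

lemma reordered_matrix_aut:
  assumes "quandle {1..n} op" "bij_betw \<mu> {1..n} {1..n}" "quandle_aut {1..n} op \<phi>"
  shows "reordered_matrix n (\<mu> \<circ> \<phi>) op = reordered_matrix n \<mu> op"
proof (rule reordered_matrix_eqI[OF _ _ extensional_reordered_matrix])
  have \<phi>: "bij_betw \<phi> {1..n} {1..n}" using assms(3) by (simp add: quandle_aut_def)
  then show "bij_betw (\<mu> \<circ> \<phi>) {1..n} {1..n}" using assms(2) by (rule bij_betw_trans)
  fix i j assume ij: "i \<in> {1..n}" "j \<in> {1..n}"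
  then have "\<phi> i \<in> {1..n}" "\<phi> j \<in> {1..n}" using \<phi> bij_betwE by blast+
  then show "reordered_matrix n \<mu> op ((\<mu> \<circ> \<phi>) i, (\<mu> \<circ> \<phi>) j) = (\<mu> \<circ> \<phi>) (op i j)"
    using reordered_matrix_entry[OF assms(2)] assms(3) ij by (simp add: quandle_aut_def)
qed

lemma reordered_matrix_cong:
  assumes "quandle {1..n} op" "bij_betw \<nu> {1..n} {1..n}" "\<And>i. i \<in> {1..n} \<Longrightarrow> \<nu> i = \<mu> i"
  shows "reordered_matrix n \<nu> op = reordered_matrix n \<mu> op"
proof (rule reordered_matrix_eqI[OF assms(2) _ extensional_reordered_matrix])
  have \<mu>: "bij_betw \<mu> {1..n} {1..n}" using assms(2,3) bij_betw_cong by metis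
  fix i j assume ij: "i \<in> {1..n}" "j \<in> {1..n}"
  then show "reordered_matrix n \<mu> op (\<nu> i, \<nu> j) = \<nu> (op i j)"
    using reordered_matrix_entry[OF \<mu> ij] assms(3) quandle.closed[OF assms(1)] by simp
qed

lemma reordered_matrix_id:
  assumes "quandle {1..n} op"
  shows "reordered_matrix n id op = quandle_matrix n op"
  by (rule reordered_matrix_eqI) (auto simp: quandle_matrix_def)

section \<open>Normalising a canonical reordering\<close>

lemma canonical_reordering_normalize:
  assumes cq: "connected_quandle {1..n} op"
    and ls: "sorted ls" "\<forall>l\<in>set ls. 1 \<le> l" "n = sum_list ls + 1"
    and col: "\<And>i. i \<in> {1..n} \<Longrightarrow> op i n = consecutive_cycles 0 ls i"
    and inj: "inj_on card (orbit (consecutive_cycles 0 ls) ` {1..n} - {{n}})"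
    and r: "r \<in> {1..n}"
    and M: "M \<in> canonical_reorderings n op"
  shows "\<exists>\<nu>. bij_betw \<nu> {1..n} {1..n} \<and> M = reordered_matrix n \<nu> op \<and> \<nu> n = n \<and> \<nu> r = r \<and>
           (\<forall>i\<in>{1..n}. \<nu> (consecutive_cycles 0 ls i) = consecutive_cycles 0 ls (\<nu> i))"
proof -
  interpret connected_quandle "{1..n}" op by (rule cq)
  note q = quandle_axioms
  define f where "f = consecutive_cycles 0 ls"
  have n: "n \<in> {1..n}" using ls by simp
  have perm_cc: "consecutive_cycles 0 ks permutes {1..n}" if "n = sum_list ks + 1" for ks
    by (rule permutes_subset[OF consecutive_cycles_permutes]) (use that in auto)
  have f: "f permutes {1..n}" unfolding f_def by (rule perm_cc[OF ls(3)])
  obtain \<nu>0 where \<nu>0: "bij_betw \<nu>0 {1..n} {1..n}" "M = reordered_matrix n \<nu>0 op"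
    and canon: "canonical_form n M"
    using M by (auto simp: canonical_reorderings_def)
  \<comment> \<open>\<open>b\<close> is the element renamed to \<open>n\<close>. An automorphism
    taking \<open>n\<close> to \<open>b\<close>, applied first, makes the renaming fix
    \<open>n\<close>.\<close>
  obtain b where b: "b \<in> {1..n}" "\<nu>0 b = n" using \<nu>0(1) n by (metis bij_betw_imp_surj_on imageE)
  obtain \<phi> where \<phi>: "quandle_aut {1..n} op \<phi>" "\<phi> n = b"
    using quandle_aut_transitive[OF n b(1)] by blast
  define \<nu> where "\<nu> = \<nu>0 \<circ> \<phi>"
  have \<nu>: "bij_betw \<nu> {1..n} {1..n}"
    using \<phi>(1) \<nu>0(1) unfolding \<nu>_def quandle_aut_def by (auto intro: bij_betw_trans)
  have M\<nu>: "M = reordered_matrix n \<nu> op"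
    unfolding \<nu>_def using reordered_matrix_aut[OF q \<nu>0(1) \<phi>(1)] \<nu>0(2) by simp
  have \<nu>n: "\<nu> n = n" using \<phi>(2) b by (simp add: \<nu>_def)
  have \<nu>in: "\<nu> i \<in> {1..n}" if "i \<in> {1..n}" for i using \<nu> that bij_betwE by blast
  obtain ks where ks: "sorted ks" "\<forall>l\<in>set ks. 1 \<le> l" "n = sum_list ks + 1"
    and Mks: "\<And>i. i \<in> {1..n} \<Longrightarrow> M (i, n) = consecutive_cycles 0 ks i"
    using canon unfolding canonical_form_def by metis
  \<comment> \<open>Since \<open>\<nu> n = n\<close>, the last column of \<open>M\<close> is the
    conjugate of \<open>f\<close> by \<open>\<nu>\<close>.\<close>
  have comm: "\<nu> (f i) = consecutive_cycles 0 ks (\<nu> i)" if i: "i \<in> {1..n}" for i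
  proof -
    have "\<nu> (f i) = \<nu> (op i n)" using col[OF i] by (simp add: f_def)
    also have "\<dots> = M (\<nu> i, \<nu> n)" using reordered_matrix_entry[OF \<nu> i n] M\<nu> by simp
    also have "\<dots> = consecutive_cycles 0 ks (\<nu> i)" using Mks \<nu>in[OF i] \<nu>n by simp
    finally show ?thesis .
  qed
  \<comment> \<open>Conjugate permutations have the same cycle type: \<open>\<nu>\<close> maps the
    orbits of \<open>f\<close> bijectively, with their sizes, onto those of the new column. Sorted
    lists with equal multisets coincide, so the two columns are the same permutation and
    \<open>\<nu>\<close> commutes with it.\<close>
  have "ks = ls"
  proof -
    let ?P = "orbit f ` {1..n}"
    have sub: "C \<subseteq> {1..n}" if "C \<in> ?P" for C using that permutes_orbit_subset[OF f] by blast
    have inj': "inj_on (image \<nu>) ?P"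
      by (rule inj_onI) (metis sub bij_betw_imp_inj_on[OF \<nu>] inj_on_image_eq_iff)
    have "orbit (consecutive_cycles 0 ks) ` {1..n} = (\<lambda>i. orbit (consecutive_cycles 0 ks) (\<nu> i)) ` {1..n}"
      using bij_betw_imp_surj_on[OF \<nu>] by (metis image_image)
    also have "\<dots> = (\<lambda>i. \<nu> ` orbit f i) ` {1..n}"
      by (rule image_cong[OF refl]) (rule orbit_image_commute[where \<nu> = \<nu>, OF f finite_atLeastAtMost _ comm])
    also have "\<dots> = image \<nu> ` ?P" by (simp add: image_image)
    finally have "add_mset 1 (mset ks) = image_mset card (mset_set (image \<nu> ` ?P))"
      using orbit_cards_consecutive_cycles[OF ks(2,3)] by simp
    also have "\<dots> = image_mset (\<lambda>C. card (\<nu> ` C)) (mset_set ?P)"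
      by (simp only: image_mset_mset_set[OF inj', symmetric] image_mset.compositionality comp_def)
    also have "\<dots> = image_mset card (mset_set ?P)"
    proof (rule image_mset_cong)
      fix C assume "C \<in># mset_set ?P"
      then have "C \<subseteq> {1..n}" using sub by simp
      then show "card (\<nu> ` C) = card C"
        by (intro card_image inj_on_subset[OF bij_betw_imp_inj_on[OF \<nu>]])
    qed
    also have "\<dots> = add_mset 1 (mset ls)"
      unfolding f_def by (rule orbit_cards_consecutive_cycles[OF ls(2,3)])
    finally have "mset ks = mset ls" by simp
    then show ?thesis using ks(1) ls(1) by (metis properties_for_sort)
  qed
  then have comm: "\<nu> (f i) = f (\<nu> i)" if "i \<in> {1..n}" for i using comm[OF that] by (simp add: f_def)
  have orbn: "orbit f n = {n}" unfolding f_def ls(3) by (rule consecutive_cycles_orbit_last)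
  have perm: "permutation f" using f by (auto simp: permutation_permutes)
  have "\<nu> r \<in> orbit f r"
  proof (rule commuting_preserves_orbits[where \<nu> = \<nu> and f = f and A = "{1..n}" and a = n and x = r,
        OF f _ _ _ comm n _ _ r])
    show "inj_on \<nu> {1..n}" "\<nu> ` {1..n} \<subseteq> {1..n}" using \<nu> by (auto simp: bij_betw_def)
    show "\<nu> n \<in> orbit f n" using \<nu>n orbn by simp
    show "inj_on card (orbit f ` {1..n} - {orbit f n})" using inj by (simp add: f_def[symmetric] orbn)
  qed simp_all
  \<comment> \<open>Some power \<open>f ^^ k\<close> takes \<open>\<nu> r\<close> back to
    \<open>r\<close>. As \<open>\<nu>\<close> commutes with \<open>f\<close>, the composite
    \<open>\<nu> \<circ> (f ^^ k)\<close> then fixes \<open>r\<close>; it still fixes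
    \<open>n\<close>, and it gives the same matrix because \<open>f\<close> acts as an
    automorphism.\<close>
  then have "r \<in> orbit f (\<nu> r)"
    using orbit_swap permutation_self_in_orbit[OF perm] by metis
  then obtain k where k: "r = (f ^^ k) (\<nu> r)"
    using orbit_altdef_permutation[OF perm, of "\<nu> r"] by auto
  have f_pow: "(f ^^ m) i \<in> {1..n}" "\<nu> ((f ^^ m) i) = (f ^^ m) (\<nu> i)" if "i \<in> {1..n}" for i m
  proof -
    show *: "(f ^^ m) i \<in> {1..n}" for m
      using that permutes_in_image[OF permutes_funpow[OF f]] by blast
    show "\<nu> ((f ^^ m) i) = (f ^^ m) (\<nu> i)"
      using * comm by (induction m) auto
  qed
  have f_col: "f i = op i n" if "i \<in> {1..n}" for i using col[OF that] by (simp add: f_def)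
  have "quandle_aut {1..n} op f"
    using quandle_aut_translation[OF n] f_col closed permutes_imp_bij[OF f]
    unfolding quandle_aut_def by simp
  then have fk: "quandle_aut {1..n} op (f ^^ k)" by (rule quandle_aut_funpow)
  let ?\<mu> = "\<nu> \<circ> (f ^^ k)"
  have "bij_betw ?\<mu> {1..n} {1..n}"
    using fk \<nu> unfolding quandle_aut_def by (auto intro: bij_betw_trans)
  moreover have "M = reordered_matrix n ?\<mu> op"
    using reordered_matrix_aut[OF q \<nu> fk] M\<nu> by simp
  moreover have "?\<mu> n = n"
  proof -
    have "f n = n" using orbn by (simp add: orbit_eq_singleton_iff)
    then have "(f ^^ k) n = n" by (induction k) auto
    then show ?thesis using \<nu>n by simp
  qed
  moreover have "?\<mu> r = r" using f_pow(2)[OF r, of k] k by simp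
  moreover have "?\<mu> (f i) = f (?\<mu> i)" if "i \<in> {1..n}" for i
    using f_pow(1)[OF that, of k] comm by (simp add: funpow_swap1[symmetric])
  ultimately show ?thesis unfolding f_def by blast
qed

section \<open>Counting the canonical forms\<close>

theorem corollary1p7:
  fixes n :: nat and op :: "nat \<Rightarrow> nat \<Rightarrow> nat" and ls :: "nat list"
  assumes "connected_quandle {1..n} op"
    and "naturally_ordered n op"
    and "profile n op = add_mset 1 (mset ls)"
    and "length ls \<ge> 1"
    and "\<forall>l\<in>set ls. 1 \<le> l"
    and "sorted_wrt (<) ls"
  shows "finite (canonical_reorderings n op)
      \<and> card (canonical_reorderings n op) \<le> prod_list (butlast ls)
      \<and> (length ls = 1 \<or> (length ls = 2 \<and> ls ! 0 = 1) \<longrightarrow>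
           (\<exists>!M. M \<in> canonical_reorderings n op))"
proof -
  interpret connected_quandle "{1..n}" op by (rule assms(1))
  obtain ks where ks: "sorted ks" "\<forall>l\<in>set ks. 1 \<le> l" "n = sum_list ks + 1"
    and col_ks: "\<And>i. i \<in> {1..n} \<Longrightarrow> quandle_matrix n op (i, n) = consecutive_cycles 0 ks i"
    using assms(2) unfolding canonical_form_def by metis
  have n: "n \<in> {1..n}" using ks by simp
  have op_ks: "op i n = consecutive_cycles 0 ks i" if "i \<in> {1..n}" for i
    using col_ks[OF that] that n by (simp add: quandle_matrix_def)
  \<comment> \<open>The natural ordering supplies some sorted list \<open>ks\<close> of cycle
    lengths; comparison with the profile identifies it with \<open>ls\<close>.\<close>
  have "orbit (\<lambda>i. op i n) ` {1..n} = orbit (consecutive_cycles 0 ks) ` {1..n}"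
    by (rule image_cong[OF refl], rule orbit_cong0[of _ "{1..n}"]) (use op_ks closed n in blast)+
  then have "add_mset 1 (mset ls) = add_mset 1 (mset ks)"
    using assms(3) orbit_cards_consecutive_cycles[OF ks(2,3)] by (simp add: profile_def)
  moreover have sorted: "sorted ls" and distinct: "distinct ls"
    using assms(6) by (auto simp: strict_sorted_iff)
  ultimately have "ks = ls" using ks(1) by (metis add_mset_add_mset_same_iff properties_for_sort)
  note op_ls = op_ks[unfolded this] and sum = ks(3)[unfolded this]
  define f where "f = consecutive_cycles 0 ls"
  define P where "P = orbit f ` {1..sum_list ls}"
  have f: "f permutes {1..n}"
    unfolding f_def by (rule permutes_subset[OF consecutive_cycles_permutes]) (use sum in auto)
  then have perm: "permutation f" by (auto simp: permutation_permutes)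
  have orbn: "orbit f n = {n}" unfolding f_def sum by (rule consecutive_cycles_orbit_last)
  have finP: "finite P" by (simp add: P_def)
  have orbits: "orbit f ` {1..n} = insert {n} P" and n_P: "{n} \<notin> P"
    using orbits_consecutive_cycles_Suc[OF sum] by (simp_all add: f_def P_def)
  have cards: "image_mset card (mset_set P) = mset ls"
    using orbits_consecutive_cycles[OF assms(5), of 0] by (simp add: f_def P_def)
  \<comment> \<open>There are \<open>length ls\<close> orbits in \<open>P\<close>, and their sizes
    form the set of the distinct entries of \<open>ls\<close>, so no size repeats.\<close>
  have cardP: "inj_on card P"
  proof (rule eq_card_imp_inj_on[OF finP])
    have "card ` P = set ls" using arg_cong[OF cards, of set_mset] finP by simp
    then show "card (card ` P) = card P"
      using arg_cong[OF cards, of size] distinct by (simp add: distinct_card)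
  qed
  have inj: "inj_on card (orbit f ` {1..n} - {{n}})"
    unfolding orbits by (rule inj_on_subset[OF cardP]) auto
  have ne: "ls \<noteq> []" using assms(4) by auto
  then have "last ls \<in># image_mset card (mset_set P)" using cards by simp
  \<comment> \<open>\<open>L\<close> is the longest cycle, whose length is to drop out of the
    product.\<close>
  then obtain L where L: "L \<in> P" "card L = last ls" using finP by auto
  define rep where "rep C = (SOME x. x \<in> C)" for C :: "nat set"
  have P_orbit: "\<exists>i\<in>{1..n}. C = orbit f i" if "C \<in> P" for C
  proof -
    have "C \<in> orbit f ` {1..n}" using that by (simp only: orbits insertI2)
    then show ?thesis by (simp only: image_iff)
  qed
  have P_sub: "C \<subseteq> {1..n}" if "C \<in> P" for C
    using P_orbit[OF that] permutes_orbit_subset[OF f] by metis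
  have P_eq: "orbit f x = C" if "C \<in> P" "x \<in> C" for C x
    using P_orbit[OF that(1)] that(2) orbit_cyclic_eq3[OF cyclic_on_orbit'[OF perm]] by metis
  have rep: "rep C \<in> C" if "C \<in> P" for C
    using P_orbit[OF that] orbit.base unfolding rep_def by (metis someI_ex)
  have repP: "rep C \<in> {1..n}" if "C \<in> P" for C
    using rep[OF that] P_sub[OF that] by (rule subsetD[rotated])
  let ?S = "canonical_reorderings n op"
  let ?good = "\<lambda>M \<nu>. bij_betw \<nu> {1..n} {1..n} \<and> M = reordered_matrix n \<nu> op \<and> \<nu> n = n \<and>
    \<nu> (rep L) = rep L \<and> (\<forall>i\<in>{1..n}. \<nu> (f i) = f (\<nu> i))"
  have "\<forall>M\<in>?S. \<exists>\<nu>. ?good M \<nu>"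
    using canonical_reordering_normalize[OF assms(1) sorted assms(5) sum op_ls inj[unfolded f_def] repP[OF L(1)]]
    unfolding f_def by blast
  then obtain N where N: "\<And>M. M \<in> ?S \<Longrightarrow> ?good M (N M)" by metis
  \<comment> \<open>The normalised renaming is recorded by its values at the representatives.
    \<open>L\<close> is left out because the value at \<open>rep L\<close> is prescribed, as is the
    value at \<open>n\<close>.\<close>
  define F where "F M = (\<lambda>C\<in>P - {L}. N M (rep C))" for M
  have F_in: "F M \<in> (\<Pi>\<^sub>E C\<in>P - {L}. C)" if M: "M \<in> ?S" for M
  proof -
    \<comment> \<open>The renaming commutes with \<open>f\<close> and fixes \<open>n\<close>, so
      distinct lengths force it to preserve each cycle.\<close>
    have "N M (rep C) \<in> C" if C: "C \<in> P" for C
    proof -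
      have "N M (rep C) \<in> orbit f (rep C)"
        by (rule commuting_preserves_orbits[where \<nu> = "N M" and f = f and A = "{1..n}" and a = n
            and x = "rep C", OF f _ _ _ _ n _ _ repP[OF C]])
          (use N[OF M] inj orbn in \<open>auto simp: bij_betw_def\<close>)
      then show ?thesis using P_eq[OF C rep[OF C]] by simp
    qed
    then show ?thesis by (auto simp: F_def)
  qed
  have F_inj: "inj_on F ?S"
  proof (rule inj_onI)
    fix M M' assume M: "M \<in> ?S" "M' \<in> ?S" and eq: "F M = F M'"
    have comm: "N M (f y) = f (N M y)" if "M \<in> ?S" "y \<in> {1..n}" for M y
      using N[OF that(1)] that(2) by blast
    \<comment> \<open>On the cycle of \<open>x\<close> the two renamings agree at one point: at
      \<open>n\<close> or \<open>rep L\<close> by normalisation, at any other representative by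
      \<open>eq\<close>. Commutation with \<open>f\<close> extends this to the whole cycle.\<close>
    have agree: "N M x = N M' x" if x: "x \<in> {1..n}" for x
    proof (cases "orbit f x = {n}")
      case True
      then have "x = n" using permutation_self_in_orbit[OF perm, of x] by simp
      then show ?thesis using N M by metis
    next
      case False
      then have C: "orbit f x \<in> P" using orbits x by blast
      let ?r = "rep (orbit f x)"
      have eq_r: "N M ?r = N M' ?r"
      proof (cases "orbit f x = L")
        case True
        then show ?thesis using N M by metis
      next
        case False
        then show ?thesis using fun_cong[OF eq, of "orbit f x"] C by (simp add: F_def)
      qed
      have "x \<in> orbit f ?r"
        using P_eq[OF C rep[OF C]] permutation_self_in_orbit[OF perm] by simp
      then show ?thesis
        using commuting_eqI[OF f repP[OF C], of "N M" "N M'", OF eq_r] comm[OF M(1)] comm[OF M(2)] by blast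
    qed
    have "bij_betw (N M) {1..n} {1..n}" using N[OF M(1)] by blast
    from reordered_matrix_cong[OF quandle_axioms this agree]
    have "reordered_matrix n (N M) op = reordered_matrix n (N M') op" .
    then show "M = M'" using N M by metis
  qed
  have finE: "finite (\<Pi>\<^sub>E C\<in>P - {L}. C)"
    using finP by (intro finite_PiE) (auto intro: finite_subset[OF P_sub])
  have sub: "F ` ?S \<subseteq> (\<Pi>\<^sub>E C\<in>P - {L}. C)" using F_in by blast
  have fin: "finite ?S" using finite_subset[OF sub finE] F_inj by (rule finite_imageD)
  have "card ?S \<le> card (\<Pi>\<^sub>E C\<in>P - {L}. C)" using card_inj_on_le[OF F_inj sub finE] .
  also have "\<dots> = prod_mset (image_mset card (mset_set (P - {L})))"
    using finP by (simp add: card_PiE prod_unfold_prod_mset)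
  \<comment> \<open>Removing \<open>L\<close> from the orbits removes one occurrence of
    \<open>last ls\<close> from the sizes.\<close>
  also have "image_mset card (mset_set (P - {L})) = mset (butlast ls)"
  proof -
    have "mset ls = add_mset (last ls) (mset (butlast ls))"
      using arg_cong[OF append_butlast_last_id[OF ne], of mset, symmetric]
      by (simp only: mset_append mset.simps union_mset_add_mset_right add_0_right)
    moreover have "mset_set P = add_mset L (mset_set (P - {L}))"
      using mset_set.remove[OF finP L(1)] .
    ultimately show ?thesis using cards L(2) by simp
  qed
  finally have bound: "card ?S \<le> prod_list (butlast ls)" by (simp add: prod_mset_prod_list)
  \<comment> \<open>The identity reordering shows that a canonical form exists, so a bound of 1
    gives uniqueness.\<close>
  have mem: "quandle_matrix n op \<in> ?S"
    using assms(2) reordered_matrix_id[OF quandle_axioms]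
    unfolding canonical_reorderings_def by (metis (mono_tags, lifting) bij_betw_id mem_Collect_eq)
  have "\<exists>!M. M \<in> ?S" if "length ls = 1 \<or> (length ls = 2 \<and> ls ! 0 = 1)"
  proof -
    \<comment> \<open>Here \<open>butlast ls\<close> is \<open>[]\<close> or
      \<open>[1]\<close>.\<close>
    have "prod_list (butlast ls) = 1"
      using that by (auto simp: length_Suc_conv numeral_2_eq_2)
    then have "card ?S \<le> Suc 0" using bound by simp
    then show ?thesis using mem fin by (metis card_le_Suc0_iff_eq)
  qed
  then show ?thesis using fin bound by blast
qed

end
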